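(* There is an online-LOCAL algorithm that finds a proper $3$-coloring of any bipartite graph with locality $O(\log n)$, where $n$ is the number of nodes.
   Context: Graphs are simple, undirected and finite; $n$ denotes the number of nodes and is known to the algorithm; $B(v,T)$ denotes the set of nodes within distance $T$ of $v$, and $G[U]$ the subgraph induced by $U$. Online-LOCAL model with locality $T=T(n)$: an adversary chooses an ordering $v_1,v_2,\dots,v_n$ of the nodes of the input graph $G$ and reveals them one at a time. Let $G_i = G\bigl[\bigcup_{j=1}^{i} B(v_j,T)\bigr]$. When $v_i$ is presented, the algorithm (which has unbounded memory of everything seen so far) must irrevocably choose the output label of $v_i$ based only on $v_1,\dots,v_i$ and $G_i$. The algorithm solves a problem with locality $T$ if for every input graph of the family and every adversarial ordering, the resulting labeling is a feasible solution. A proper $3$-coloring assigns each node a color in $\{0,1,2\}$ so that adjacent nodes receive different colors. *)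

theory Defs
  imports
    "Graph_Theory.Pair_Digraph"
    "Graph_Theory.Digraph_Component"
    "Graph_Theory.Shortest_Path"
    "HOL-Library.Landau_Symbols"
begin

text \<open>
  A finite simple undirected graph is a \<^const>\<open>pair_graph\<close>: a finite, loop-free, symmetric
  digraph whose arcs are pairs of nodes. The pair representation matters here: in a general
  \<^typ>\<open>('a, 'b) pre_digraph\<close> an induced subgraph keeps the total functions tail and head of the
  host graph, so handing it to an algorithm would reveal more than the subgraph itself.
\<close>

definition induced :: "'v pair_pre_digraph \<Rightarrow> 'v set \<Rightarrow> 'v pair_pre_digraph" where
  "induced G U = \<lparr> pverts = U, parcs = {e \<in> parcs G. fst e \<in> U \<and> snd e \<in> U} \<rparr>"

lemma with_proj_induced: "with_proj (induced G U) = with_proj G \<restriction> U"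
  by (simp add: induced_def with_proj_def induce_subgraph_def)

definition graph_dist :: "'v pair_pre_digraph \<Rightarrow> 'v \<Rightarrow> 'v \<Rightarrow> ereal" where
  "graph_dist G u v = wf_digraph.\<mu> (with_proj G) (\<lambda>_. 1) u v"

definition graph_ball :: "'v pair_pre_digraph \<Rightarrow> 'v \<Rightarrow> nat \<Rightarrow> 'v set" where
  "graph_ball G v T = {u \<in> pverts G. graph_dist G v u \<le> ereal (real T)}"

lemma graph_ball_awalk:
  fixes G :: "'v pair_pre_digraph"
  assumes "pair_graph G"
  shows "graph_ball G v T = {u. \<exists>p. pre_digraph.awalk (with_proj G) v p u \<and> length p \<le> T}"
proof -
  interpret pair_graph G by fact
  have cost: "awalk_cost (\<lambda>_. 1) p = real (length p)" for p :: "('v \<times> 'v) list"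
    by (induct p) auto
  have "graph_dist G v u \<le> ereal (real T) \<longleftrightarrow> (\<exists>p. awalk v p u \<and> length p \<le> T)" for u
  proof
    assume le: "graph_dist G v u \<le> ereal (real T)"
    then have "\<mu> (\<lambda>_. 1) v u < \<infinity>"
      by (auto simp: graph_dist_def)
    then have "v \<rightarrow>\<^sup>*\<^bsub>with_proj G\<^esub> u"
      by (simp only: \<mu>_reach_conv)
    then obtain p where "apath v p u" "\<mu> (\<lambda>_. 1) v u = awalk_cost (\<lambda>_. 1) p"
      using min_cost_awalk[of v u "\<lambda>_. 1"] by auto
    with le show "\<exists>p. awalk v p u \<and> length p \<le> T"
      by (auto simp: graph_dist_def cost apath_def)
  next
    assume "\<exists>p. awalk v p u \<and> length p \<le> T"
    then obtain p where p: "awalk v p u" "length p \<le> T" by blast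
    have "\<mu> (\<lambda>_. 1) v u \<le> ereal (real (length p))"
      using min_cost_le_walk_cost[OF p(1), of "\<lambda>_. 1"] by (simp add: cost)
    also have "\<dots> \<le> ereal (real T)" using p(2) by simp
    finally show "graph_dist G v u \<le> ereal (real T)" by (simp add: graph_dist_def)
  qed
  then show ?thesis
    by (auto simp: graph_ball_def)
qed

definition bipartite :: "'v pair_pre_digraph \<Rightarrow> bool" where
  "bipartite G \<longleftrightarrow> (\<exists>X Y. X \<union> Y = pverts G \<and> X \<inter> Y = {} \<and> parcs G \<subseteq> X \<times> Y \<union> Y \<times> X)"

definition proper_coloring :: "nat \<Rightarrow> 'v pair_pre_digraph \<Rightarrow> ('v \<Rightarrow> nat) \<Rightarrow> bool" where
  "proper_coloring k G c \<longleftrightarrow>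
    (\<forall>v \<in> pverts G. c v \<in> {0..<k}) \<and> (\<forall>(u, v) \<in> parcs G. c u \<noteq> c v)"

text \<open>
  An online-LOCAL algorithm maps the number of nodes of the input graph, the nodes
  \<open>v\<^sub>1, \<dots>, v\<^sub>i\<close> presented so far and the graph \<open>G\<^sub>i\<close> to the label of \<open>v\<^sub>i\<close>. It need not be
  given its earlier outputs or the graphs \<open>G\<^sub>j\<close> with \<open>j < i\<close>, since these are determined by its
  arguments: for \<open>j \<le> i\<close> the ball around \<open>v\<^sub>j\<close> in \<open>G\<^sub>i\<close> is the one in the input graph.
\<close>

type_synonym ('v, 'l) online_algorithm =
  "nat \<Rightarrow> 'v list \<Rightarrow> 'v pair_pre_digraph \<Rightarrow> 'l"

definition revealed :: "'v pair_pre_digraph \<Rightarrow> nat \<Rightarrow> 'v list \<Rightarrow> 'v pair_pre_digraph" where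
  "revealed G T ws = induced G (\<Union>w \<in> set ws. graph_ball G w T)"

definition is_ordering :: "'v pair_pre_digraph \<Rightarrow> 'v list \<Rightarrow> bool" where
  "is_ordering G vs \<longleftrightarrow> distinct vs \<and> set vs = pverts G"

text \<open>
  The label of \<open>v\<close> is fixed when the adversary has presented exactly the prefix of
  its ordering \<open>vs\<close> that ends with \<open>v\<close>.
\<close>

definition online_labeling ::
  "('v, 'l) online_algorithm \<Rightarrow> (nat \<Rightarrow> nat) \<Rightarrow> 'v pair_pre_digraph \<Rightarrow> 'v list \<Rightarrow> 'v \<Rightarrow> 'l" where
  "online_labeling A T G vs v =
    (let n = card (pverts G); ws = takeWhile (\<lambda>u. u \<noteq> v) vs @ [v]
     in A n ws (revealed G (T n) ws))"

lemma online_labeling_nth: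
  assumes "distinct vs" "i < length vs"
  shows "online_labeling A T G vs (vs ! i) =
    A (card (pverts G)) (take (Suc i) vs) (revealed G (T (card (pverts G))) (take (Suc i) vs))"
proof -
  have "takeWhile (\<lambda>u. u \<noteq> vs ! i) vs = take i vs"
    using assms by (intro takeWhile_eq_take_P_nth) (auto simp: nth_eq_iff_index_eq)
  then show ?thesis
    using assms(2) by (simp add: online_labeling_def Let_def take_Suc_conv_app_nth)
qed

definition solves_online_LOCAL ::
  "('v, 'l) online_algorithm \<Rightarrow> (nat \<Rightarrow> nat) \<Rightarrow> ('v pair_pre_digraph \<Rightarrow> bool) \<Rightarrow>
   ('v pair_pre_digraph \<Rightarrow> ('v \<Rightarrow> 'l) \<Rightarrow> bool) \<Rightarrow> bool" where
  "solves_online_LOCAL A T family feasible \<longleftrightarrow>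
    (\<forall>G vs. pair_graph G \<and> family G \<and> is_ordering G vs \<longrightarrow> feasible G (online_labeling A T G vs))"

end

theory Submission
  imports Defs "HOL-Library.Discrete_Functions"
begin

text \<open>
  The algorithm keeps a proper 3-coloring of the whole revealed graph and outputs its value at the
  presented node; only the colors of nodes presented earlier are binding. Each component carries a
  rank \<open>b\<close> such that it contains at least \<open>2 ^ b\<close> presented nodes, and at distance more than \<open>3 b\<close>
  from the presented nodes its coloring is a 2-coloring. When a new node merges components whose
  2-colorings disagree, the component of largest rank decides, and every component that disagrees
  with it switches its 2-coloring inside two further layers by means of the third color. This raises
  the rank by one; the merged rank exceeds the largest old rank only if two components of equal
  rank disagreed, so the number of presented nodes has doubled. Hence \<open>b \<le> log\<^sub>2 n\<close>, and the
  layers needed for switching are visible with locality \<open>3 log\<^sub>2 n + 4\<close>.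
\<close>

section \<open>Balls in a relation and in a graph\<close>

fun near :: "'v rel \<Rightarrow> 'v set \<Rightarrow> nat \<Rightarrow> 'v set" where
  "near E S 0 = S"
| "near E S (Suc k) = near E S k \<union> E `` near E S k"

lemma near_mono: "j \<le> k \<Longrightarrow> near E S j \<subseteq> near E S k"
  by (induction k) (auto simp: le_Suc_eq)

lemma near_increasing: "S \<subseteq> near E S k"
  using near_mono[of 0 k E S] by simp

lemma near_mono_rel: "E \<subseteq> E' \<Longrightarrow> S \<subseteq> S' \<Longrightarrow> near E S k \<subseteq> near E' S' k"
  by (induction k) (simp_all, blast)

lemma near_UN: "near E (\<Union>i\<in>I. S i) k = (\<Union>i\<in>I. near E (S i) k)"
  by (induction k) auto

lemma near_insert: "near E (insert v S) k = near E {v} k \<union> near E S k"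
  by (induction k) auto

lemma near_subset_reachable: "near E S k \<subseteq> E\<^sup>* `` S"
  by (induction k) (auto intro: rtrancl.rtrancl_into_rtrancl)

lemma near_step: "u \<in> near E S k \<Longrightarrow> (u, w) \<in> E \<Longrightarrow> w \<in> near E S (Suc k)"
  by auto

text \<open>A path of at most \<open>T\<close> steps from \<open>S\<close> never leaves the ball of
  radius \<open>T\<close> around \<open>S'\<close>. Hence balls around presented nodes can be
  computed from the visible arcs alone.\<close>

lemma near_restrict:
  assumes "k \<le> T" "S \<subseteq> S'"
  shows "near (Restr E (near E S' T)) S k = near E S k"
  using assms(1)
proof (induction k)
  case (Suc k)
  have "near E S (Suc k) \<subseteq> near E S' T"
    using near_mono[OF Suc.prems, of E S'] near_mono_rel[OF subset_refl assms(2), of E "Suc k"] by blast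
  then show ?case
    using Suc by auto
qed simp

text \<open>Splitting off the last arc of a walk matches the recursion of \<open>near\<close>. The
  empty walk at \<open>v\<close> exists only if \<open>v\<close> is a node.\<close>

lemma graph_ball_eq_near:
  assumes "pair_graph G" "v \<in> pverts G"
  shows "graph_ball G v T = near (parcs G) {v} T"
proof -
  interpret pair_graph G by fact
  have snoc: "awalk v (p @ [e]) u \<longleftrightarrow> awalk v p (fst e) \<and> e \<in> parcs G \<and> snd e = u" for p e u
    by (auto simp: awalk_simps)
  have "(\<exists>p. awalk v p u \<and> length p \<le> T) \<longleftrightarrow> u \<in> near (parcs G) {v} T" for u
  proof (induction T arbitrary: u)
    case 0
    then show ?case using assms(2) by (auto simp: awalk_Nil_iff)
  next
    case (Suc T)
    have "(\<exists>p. awalk v p u \<and> length p \<le> Suc T) \<longleftrightarrow>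
      (\<exists>p. awalk v p u \<and> length p \<le> T) \<or> (\<exists>p e. awalk v (p @ [e]) u \<and> length p \<le> T)"
    proof
      assume "\<exists>p. awalk v p u \<and> length p \<le> Suc T"
      then obtain p where p: "awalk v p u" "length p \<le> Suc T" by blast
      show "(\<exists>p. awalk v p u \<and> length p \<le> T) \<or> (\<exists>p e. awalk v (p @ [e]) u \<and> length p \<le> T)"
      proof (cases p rule: rev_cases)
        case Nil
        then show ?thesis using p by auto
      next
        case (snoc q e)
        then show ?thesis using p by (metis Suc_le_mono length_append_singleton)
      qed
    next
      assume "(\<exists>p. awalk v p u \<and> length p \<le> T) \<or> (\<exists>p e. awalk v (p @ [e]) u \<and> length p \<le> T)"
      then show "\<exists>p. awalk v p u \<and> length p \<le> Suc T"
        by (metis le_Suc_eq length_append_singleton not_less_eq_eq)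
    qed
    also have "\<dots> \<longleftrightarrow> u \<in> near (parcs G) {v} (Suc T)"
      unfolding snoc near.simps Un_iff Image_iff Bex_def Suc.IH[symmetric]
      by (simp add: split_paired_Ex) blast
    finally show ?case .
  qed
  then show ?thesis
    by (auto simp: graph_ball_awalk[OF assms(1)])
qed

declare near.simps(2) [simp del]

lemma parcs_revealed:
  assumes "pair_graph G" "set ws \<subseteq> pverts G"
  shows "parcs (revealed G T ws) = Restr (parcs G) (near (parcs G) (set ws) T)"
proof -
  have "(\<Union>w\<in>set ws. graph_ball G w T) = near (parcs G) (set ws) T"
    using near_UN[of "parcs G" "\<lambda>w. {w}" "set ws" T] assms graph_ball_eq_near[OF assms(1)]
    by (auto simp: subset_iff)
  then show ?thesis
    by (auto simp: revealed_def induced_def)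
qed

section \<open>Ranked colorings and the merging of components\<close>

text \<open>Here \<open>b\<close> is the rank and \<open>s\<close> the bipartition of the component of a node.\<close>

definition valid_state :: "'v rel \<Rightarrow> 'v set \<Rightarrow> ('v \<Rightarrow> nat) \<Rightarrow> bool" where
  "valid_state E S \<phi> \<longleftrightarrow>
    (\<forall>u. \<phi> u < 3) \<and> (\<forall>(u, w) \<in> E. \<phi> u \<noteq> \<phi> w) \<and>
    (\<exists>b s. (\<forall>(u, w) \<in> E. b u = b w \<and> s u \<noteq> s w) \<and>
      (\<forall>u. u \<notin> near E S (3 * b u) \<longrightarrow> \<phi> u = of_bool (s u)) \<and>
      (\<forall>u\<in>S. 2 ^ b u \<le> card (S \<inter> E\<^sup>* `` {u})))"

lemma rtrancl_invariant:
  assumes "(u, w) \<in> E\<^sup>*" "\<And>x y. (x, y) \<in> E \<Longrightarrow> f x = f y"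
  shows "f u = f w"
  using assms(1) by induction (auto dest: assms(2))

text \<open>\<open>E'\<close> stands for the old visible arcs, \<open>V'\<close> for the old visible
  nodes and \<open>M\<close> for the new component of \<open>v\<close>. A bipartition of
  \<open>M\<close> is fixed up to swapping, so \<open>s'\<close> can be made to agree with
  \<open>s\<close> at a presented node of maximal rank in \<open>M\<close>. The strict bound at
  disagreeing nodes leaves room for the switching layers.\<close>

lemma merge_ranks:
  fixes b :: "'v \<Rightarrow> nat" and s t :: "'v \<Rightarrow> bool"
  assumes "sym E" "finite S" "E' \<subseteq> E"
    and t: "\<And>u w. (u, w) \<in> E \<Longrightarrow> t u \<noteq> t w"
    and bs: "\<And>u w. (u, w) \<in> E' \<Longrightarrow> b u = b w \<and> s u \<noteq> s w"
    and rank: "\<And>u. u \<in> S \<Longrightarrow> 2 ^ b u \<le> card (S \<inter> E'\<^sup>* `` {u})"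
    and M: "M = E\<^sup>* `` {v}"
    and V': "V' \<subseteq> E'\<^sup>* `` S"
  obtains s' B where "\<And>u w. (u, w) \<in> E \<Longrightarrow> s' u \<noteq> s' w"
    "\<And>u. u \<in> M \<inter> V' \<Longrightarrow> b u \<le> B"
    "\<And>u. u \<in> M \<inter> V' \<Longrightarrow> s u \<noteq> s' u \<Longrightarrow> b u < B"
    "2 ^ B \<le> card (insert v S \<inter> M)"
proof -
  have "sym (E\<^sup>*)" using assms(1) by (rule sym_rtrancl)
  then have E'M: "u \<in> M \<longleftrightarrow> w \<in> M" if "(u, w) \<in> E'\<^sup>*" for u w
    using that rtrancl_mono[OF assms(3)] unfolding M
    by (metis Image_singleton_iff rtrancl_trans subsetD symD)
  show ?thesis
  proof (cases "M \<inter> S = {}")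
    \<comment> \<open>\<open>M\<close> then contains no old visible node, and \<open>v\<close> alone
      supports rank 0.\<close>
    case True
    then have "M \<inter> V' = {}" using V' E'M by blast
    moreover have "2 ^ 0 \<le> card (insert v S \<inter> M)"
      using M assms(2) by (auto simp: Suc_le_eq card_gt_0_iff)
    ultimately show ?thesis using that[of t 0] t by blast
  next
    case False
    have bE': "b u = b w" if "(u, w) \<in> E'\<^sup>*" for u w
      using that by (rule rtrancl_invariant) (use bs in auto)
    have source: "\<exists>x \<in> M \<inter> S. (x, u) \<in> E'\<^sup>*" if "u \<in> M \<inter> V'" for u
      using that V' E'M by blast
    have fin: "finite (b ` (M \<inter> S))" using assms(2) by auto
    have "Max (b ` (M \<inter> S)) \<in> b ` (M \<inter> S)"
      using fin False by (intro Max_in) auto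
    then obtain m where m: "m \<in> M \<inter> S" "b m = Max (b ` (M \<inter> S))" by (metis imageE)
    define s' where "s' u = (if t m = s m then t u else \<not> t u)" for u
    have s': "s' u \<noteq> s' w" if "(u, w) \<in> E" for u w
      using t[OF that] by (auto simp: s'_def)
    \<comment> \<open>Both bipartitions alternate along \<open>E'\<close>, so agreement is constant
      on each old component.\<close>
    have agree: "(s u = s' u) = (s w = s' w)" if "(u, w) \<in> E'\<^sup>*" for u w
      using that
    proof (rule rtrancl_invariant)
      show "(s x = s' x) = (s y = s' y)" if "(x, y) \<in> E'" for x y
        using bs[OF that] s'[of x y] that assms(3) by auto
    qed
    have le: "b u \<le> b m" if "u \<in> M \<inter> V'" for u
    proof -
      obtain x where x: "x \<in> M \<inter> S" "(x, u) \<in> E'\<^sup>*" using source[OF \<open>u \<in> M \<inter> V'\<close>] by blast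
      have "b x \<le> b m" using x fin m(2) by simp
      then show ?thesis using bE'[OF x(2)] by simp
    qed
    have fM: "finite (insert v S \<inter> M)" using assms(2) by simp
    have sub: "S \<inter> E'\<^sup>* `` {x} \<subseteq> insert v S \<inter> M" if "x \<in> M" for x
      using that E'M by blast
    show ?thesis
    proof (cases "\<exists>u\<in>M \<inter> S. s u \<noteq> s' u \<and> b u = b m")
      case True
      then obtain u where u: "u \<in> M \<inter> S" "s u \<noteq> s' u" "b u = b m" by blast
      \<comment> \<open>\<open>s'\<close> agrees with \<open>s\<close> at \<open>m\<close> but not
        at \<open>u\<close>, so these lie in different old components, each with at least
        \<open>2 ^ b m\<close> presented nodes.\<close>
      have disj: "(S \<inter> E'\<^sup>* `` {u}) \<inter> (S \<inter> E'\<^sup>* `` {m}) = {}"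
      proof -
        have "s m = s' m" by (simp add: s'_def)
        then show ?thesis using u(2) agree[of u] agree[of m] by blast
      qed
      have "2 ^ Suc (b m) = 2 ^ b u + (2 ^ b m :: nat)" using u by simp
      also have "\<dots> \<le> card (S \<inter> E'\<^sup>* `` {u}) + card (S \<inter> E'\<^sup>* `` {m})"
        using rank[of u] rank[of m] u m by auto
      also have "\<dots> = card ((S \<inter> E'\<^sup>* `` {u}) \<union> (S \<inter> E'\<^sup>* `` {m}))"
        using assms(2) disj by (subst card_Un_disjoint) auto
      also have "\<dots> \<le> card (insert v S \<inter> M)"
        using sub u m by (intro card_mono fM) auto
      finally show ?thesis
        using that[of s' "Suc (b m)"] s' le by (metis le_imp_less_Suc le_SucI)
    next
      case F: False
      have "b u < b m" if u: "u \<in> M \<inter> V'" "s u \<noteq> s' u" for u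
      proof -
        obtain x where x: "x \<in> M \<inter> S" "(x, u) \<in> E'\<^sup>*" using source[OF u(1)] by blast
        have "b x \<noteq> b m" using F x agree[OF x(2)] u(2) by blast
        then show ?thesis using bE'[OF x(2)] le[OF u(1)] by simp
      qed
      moreover have "2 ^ b m \<le> card (insert v S \<inter> M)"
        using rank[of m] m card_mono[OF fM sub[of m]] by auto
      ultimately show ?thesis
        using that[of s' "b m"] s' le by blast
    qed
  qed
qed

section \<open>Extending the coloring by one presented node\<close>

text \<open>Here \<open>E\<close> stands for the arcs visible once \<open>v\<close> is presented.
  Only the component of \<open>v\<close> is recolored, and only outside \<open>S\<close>; by
  \<open>covered\<close>, the arcs of any other component were all visible before.\<close>

lemma valid_state_extend:
  assumes "sym E" "finite S"
    and covered: "E \<subseteq> near E (insert v S) T \<times> near E (insert v S) T"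
    and t: "\<And>u w. (u, w) \<in> E \<Longrightarrow> t u \<noteq> (t w :: bool)"
    and T: "\<And>k. 2 ^ k \<le> card S \<Longrightarrow> 3 * k + 4 \<le> T"
    and valid: "valid_state (Restr E (near E S T)) S \<phi>'"
  shows "\<exists>\<phi>. valid_state E (insert v S) \<phi> \<and> (\<forall>u\<in>S. \<phi> u = \<phi>' u)"
proof -
  define V' where "V' = near E S T"
  define E' where "E' = Restr E V'"
  define M where "M = E\<^sup>* `` {v}"
  have E'E: "E' \<subseteq> E" by (auto simp: E'_def)
  have near': "near E' S k = near E S k" if "k \<le> T" for k
    unfolding E'_def V'_def using that by (rule near_restrict) simp
  obtain b s where lt3: "\<And>u. \<phi>' u < 3" and proper: "\<And>u w. (u, w) \<in> E' \<Longrightarrow> \<phi>' u \<noteq> \<phi>' w"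
    and bs: "\<And>u w. (u, w) \<in> E' \<Longrightarrow> b u = b w \<and> s u \<noteq> s w"
    and far: "\<And>u. u \<notin> near E' S (3 * b u) \<Longrightarrow> \<phi>' u = of_bool (s u)"
    and rank: "\<And>u. u \<in> S \<Longrightarrow> 2 ^ b u \<le> card (S \<inter> E'\<^sup>* `` {u})"
  proof -
    have v: "valid_state E' S \<phi>'" using valid by (simp add: E'_def V'_def)
    from v obtain b s where
      "\<forall>(u, w) \<in> E'. b u = b w \<and> s u \<noteq> s w"
      "\<forall>u. u \<notin> near E' S (3 * b u) \<longrightarrow> \<phi>' u = of_bool (s u)"
      "\<forall>u\<in>S. 2 ^ b u \<le> card (S \<inter> E'\<^sup>* `` {u})"
      unfolding valid_state_def by (elim conjE exE)
    then show ?thesis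
      using v by (intro that[of b s]) (auto simp: valid_state_def)
  qed
  have V'_reach: "V' \<subseteq> E'\<^sup>* `` S"
    using near_subset_reachable[of E' S T] near'[of T] by (simp add: V'_def)
  have bT: "3 * b u + 4 \<le> T" if u: "u \<in> V'" for u
  proof -
    obtain x where x: "x \<in> S" "(x, u) \<in> E'\<^sup>*" using V'_reach u by blast
    have "b x = b u" using x(2) by (rule rtrancl_invariant) (use bs in auto)
    moreover have "2 ^ b x \<le> card S"
      using rank[OF x(1)] card_mono[OF assms(2), of "S \<inter> E'\<^sup>* `` {x}"] by simp
    ultimately show ?thesis using T by simp
  qed
  have far': "\<phi>' u = of_bool (s u)" if "u \<in> V'" "u \<notin> near E S (3 * b u)" for u
    using far[of u] near'[of "3 * b u"] bT[OF that(1)] that(2) by simp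
  obtain s' B where s': "\<And>u w. (u, w) \<in> E \<Longrightarrow> s' u \<noteq> s' w"
    and bB: "\<And>u. u \<in> M \<inter> V' \<Longrightarrow> b u \<le> B"
    and bB': "\<And>u. u \<in> M \<inter> V' \<Longrightarrow> s u \<noteq> s' u \<Longrightarrow> b u < B"
    and B: "2 ^ B \<le> card (insert v S \<inter> M)"
  proof (rule merge_ranks[OF assms(1,2) E'E t bs rank M_def V'_reach], goal_cases)
    case (4 s' B)
    show ?thesis by (rule that[OF 4(2-5)])
  qed
  \<comment> \<open>\<open>\<psi>\<close> switches from \<open>s\<close> to its complement. The layer at distance \<open>3 b + 1\<close> keeps its color: there
    \<open>\<phi>'\<close> already follows \<open>s\<close>, so it avoids the color 2 of the next layer.\<close>
  define \<psi> where "\<psi> u =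
    (if u \<in> near E S (3 * b u + 1) then \<phi>' u
     else if u \<in> near E S (3 * b u + 2) then (if s u then 2 else 0)
     else if u \<in> near E S (3 * b u + 3) then (if s u then 2 else 1)
     else of_bool (\<not> s u))" for u
  \<comment> \<open>Inside \<open>M \<inter> V'\<close> the test \<open>s u = s' u\<close> has the
    same outcome at both ends of an arc, so \<open>\<phi>'\<close> and \<open>\<psi>\<close> never
    meet along an arc.\<close>
  define \<phi> where "\<phi> u =
    (if u \<notin> M then \<phi>' u
     else if u \<notin> V' then of_bool (s' u)
     else if s u = s' u then \<phi>' u else \<psi> u)" for u
  \<comment> \<open>At distances \<open>3 * b u + 1\<close>, \<open>3 * b u + 2\<close>,
    \<open>3 * b u + 3\<close> and beyond, the class of \<open>s\<close> has the colors 1, 2, 2, 0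
    and the other class 0, 0, 1, 1. An arc joins opposite classes in equal or consecutive layers,
    where these colors differ.\<close>
  have \<psi>_proper: "\<psi> u \<noteq> \<psi> w" if uw: "(u, w) \<in> E'" for u w
  proof -
    have wu: "(w, u) \<in> E" and uwE: "(u, w) \<in> E" and V: "u \<in> V'" "w \<in> V'"
      using uw assms(1) by (auto simp: E'_def dest: symD)
    have bw: "b w = b u" and sw: "s w = (\<not> s u)" using bs[OF uw] by auto
    let ?N = "\<lambda>k. near E S (3 * b u + k)"
    have up: "w \<in> ?N (Suc k)" if "u \<in> ?N k" for k
      using near_step[OF that uwE] by simp
    have dn: "u \<in> ?N (Suc k)" if "w \<in> ?N k" for k
      using near_step[OF that wu] by simp
    have m: "?N j \<subseteq> ?N k" if "j \<le> k" for j k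
      using that by (intro near_mono) simp
    have steps: "u \<in> ?N 0 \<Longrightarrow> w \<in> ?N 1" "u \<in> ?N 1 \<Longrightarrow> w \<in> ?N 2" "u \<in> ?N 2 \<Longrightarrow> w \<in> ?N 3"
      "w \<in> ?N 0 \<Longrightarrow> u \<in> ?N 1" "w \<in> ?N 1 \<Longrightarrow> u \<in> ?N 2" "w \<in> ?N 2 \<Longrightarrow> u \<in> ?N 3"
      using up[of 0] up[of 1] up[of 2] dn[of 0] dn[of 1] dn[of 2]
      by (simp_all add: numeral_2_eq_2 numeral_3_eq_3)
    have fu: "u \<notin> ?N 0 \<Longrightarrow> \<phi>' u = of_bool (s u)" "w \<notin> ?N 0 \<Longrightarrow> \<phi>' w = of_bool (\<not> s u)"
      using far'[OF V(1)] far'[OF V(2)] bw sw by auto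
    have mono: "u \<in> ?N 0 \<Longrightarrow> u \<in> ?N 1" "w \<in> ?N 0 \<Longrightarrow> w \<in> ?N 1"
      "u \<in> ?N 1 \<Longrightarrow> u \<in> ?N 2" "w \<in> ?N 1 \<Longrightarrow> w \<in> ?N 2"
      "u \<in> ?N 2 \<Longrightarrow> u \<in> ?N 3" "w \<in> ?N 2 \<Longrightarrow> w \<in> ?N 3"
      using m[of 0 1] m[of 1 2] m[of 2 3] by (simp_all add: subset_iff)
    show ?thesis
      using proper[OF uw] steps fu mono unfolding \<psi>_def bw sw
      by (cases "s u"; cases "u \<in> ?N 0"; cases "w \<in> ?N 0") (auto split: if_splits)
  qed
  \<comment> \<open>A neighbor \<open>w\<close> outside \<open>V'\<close> has distance more than
    \<open>T\<close> from \<open>S\<close>, so \<open>u\<close> lies beyond all switching layers.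
    Both \<open>\<phi>'\<close> and \<open>\<psi>\<close> are 2-colorings there, so
    \<open>s'\<close> continues across the boundary.\<close>
  have boundary: "\<phi> u = of_bool (s' u)" if uw: "(u, w) \<in> E" and V: "u \<in> V'" "w \<notin> V'" and "u \<in> M"
    for u w
  proof -
    have "u \<notin> near E S (3 * b u + 3)"
    proof
      assume "u \<in> near E S (3 * b u + 3)"
      then have "w \<in> near E S (Suc (3 * b u + 3))" using uw by (rule near_step)
      then show False using near_mono[of "Suc (3 * b u + 3)" T E S] bT[OF V(1)] V(2)
        by (auto simp: V'_def)
    qed
    then have nu: "u \<notin> near E S k" if "k \<le> 3 * b u + 3" for k
      using near_mono[OF that, of E S] by blast
    then have "\<phi>' u = of_bool (s u)" "\<psi> u = of_bool (\<not> s u)"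
      using far'[OF V(1)] by (simp_all add: \<psi>_def)
    then show ?thesis using that by (auto simp: \<phi>_def)
  qed
  have ME: "u \<in> M \<longleftrightarrow> w \<in> M" if "(u, w) \<in> E" for u w
    using that assms(1) unfolding M_def by (auto intro: rtrancl_into_rtrancl dest: symD)
  \<comment> \<open>Visible nodes outside \<open>M\<close> are near \<open>S\<close> rather than
    near \<open>v\<close>, so their arcs were visible before.\<close>
  have outside: "(u, w) \<in> E'" if "(u, w) \<in> E" "u \<notin> M" for u w
  proof -
    have "near E {v} T \<subseteq> M" using near_subset_reachable[of E "{v}" T] by (simp add: M_def)
    then show ?thesis
      using that ME[OF that(1)] covered near_insert[of E v S T] by (auto simp: E'_def V'_def)
  qed
  have \<phi>_proper: "\<phi> u \<noteq> \<phi> w" if uw: "(u, w) \<in> E" for u w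
  proof (cases "u \<in> M")
    case False
    then show ?thesis using outside[OF uw] proper ME[OF uw] by (simp add: \<phi>_def)
  next
    case True
    have wM: "w \<in> M" using True ME[OF uw] by simp
    have wu: "(w, u) \<in> E" using uw assms(1) by (auto dest: symD)
    note ne = s'[OF uw]
    consider "u \<in> V'" "w \<in> V'" | "u \<in> V'" "w \<notin> V'" | "u \<notin> V'" "w \<in> V'" | "u \<notin> V'" "w \<notin> V'" by blast
    then show ?thesis
    proof cases
      case 1
      then have uw': "(u, w) \<in> E'" using uw by (simp add: E'_def)
      show ?thesis
        using 1 True wM ne bs[OF uw'] proper[OF uw'] \<psi>_proper[OF uw'] by (auto simp: \<phi>_def)
    next
      case 2
      then show ?thesis using boundary[OF uw 2 True] ne wM by (auto simp: \<phi>_def[of w])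
    next
      case 3
      then show ?thesis using boundary[OF wu 3(2,1) wM] ne True by (auto simp: \<phi>_def[of u])
    next
      case 4
      then show ?thesis using ne wM True by (auto simp: \<phi>_def)
    qed
  qed
  define b' where "b' u = (if u \<in> M then B else b u)" for u
  define s'' where "s'' u = (if u \<in> M then s' u else s u)" for u
  have far_new: "\<phi> u = of_bool (s'' u)" if nu: "u \<notin> near E (insert v S) (3 * b' u)" for u
  proof (cases "u \<in> M")
    case False
    have "near E' S (3 * b u) \<subseteq> near E (insert v S) (3 * b u)"
      using E'E by (intro near_mono_rel) auto
    then have "u \<notin> near E' S (3 * b u)" using nu False by (auto simp: b'_def)
    then show ?thesis using far False by (simp add: \<phi>_def s''_def)
  next
    case True
    have nuS: "u \<notin> near E S k" if "k \<le> 3 * B" for k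
      using near_mono[OF that, of E S] nu True near_insert[of E v S "3 * B"] by (auto simp: b'_def)
    show ?thesis
    proof (cases "u \<in> V'")
      case uV: True
      have a: "\<phi>' u = of_bool (s u)" using far'[OF uV] nuS bB uV True by simp
      \<comment> \<open>From \<open>b u < B\<close> follows \<open>3 * b u + 3 \<le> 3 * B\<close>:
        the switching layers fit into the new radius. This is why each unit of rank is worth three
        layers.\<close>
      have "\<psi> u = of_bool (\<not> s u)" if "s u \<noteq> s' u"
        using nuS bB'[of u] uV True that by (simp add: \<psi>_def)
      then show ?thesis using True uV a by (auto simp: \<phi>_def s''_def)
    qed (use True in \<open>auto simp: \<phi>_def s''_def\<close>)
  qed
  have rank_new: "2 ^ b' u \<le> card (insert v S \<inter> E\<^sup>* `` {u})" if u: "u \<in> insert v S" for u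
  proof (cases "u \<in> M")
    case True
    then have "(u, v) \<in> E\<^sup>*" using sym_rtrancl[OF assms(1)] by (auto simp: M_def dest: symD)
    then have "M \<subseteq> E\<^sup>* `` {u}" by (auto simp: M_def intro: rtrancl_trans)
    then have "card (insert v S \<inter> M) \<le> card (insert v S \<inter> E\<^sup>* `` {u})"
      using assms(2) by (intro card_mono) auto
    then show ?thesis using B True by (simp add: b'_def)
  next
    case False
    then have "u \<in> S" using u by (auto simp: M_def)
    have "E'\<^sup>* `` {u} \<subseteq> E\<^sup>* `` {u}" using rtrancl_mono[OF E'E] by auto
    then have "card (S \<inter> E'\<^sup>* `` {u}) \<le> card (insert v S \<inter> E\<^sup>* `` {u})"
      using assms(2) by (intro card_mono) auto
    then show ?thesis using rank[OF \<open>u \<in> S\<close>] False by (simp add: b'_def)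
  qed
  have bs_new: "b' u = b' w \<and> s'' u \<noteq> s'' w" if "(u, w) \<in> E" for u w
    using ME[OF that] s'[OF that] outside[OF that] bs[of u w] by (auto simp: b'_def s''_def)
  have lt3_new: "\<phi> u < 3" for u
    using lt3[of u] by (auto simp: \<phi>_def \<psi>_def)
  have "valid_state E (insert v S) \<phi>"
    unfolding valid_state_def using lt3_new \<phi>_proper bs_new far_new rank_new
    by (intro conjI exI[of _ b'] exI[of _ s'']) auto
  \<comment> \<open>Presented nodes lie where \<open>\<psi>\<close> keeps \<open>\<phi>'\<close>, so
    switching never touches an output.\<close>
  moreover have "\<phi> u = \<phi>' u" if "u \<in> S" for u
  proof -
    have "u \<in> V'" "u \<in> near E S (3 * b u + 1)" using that near_increasing[of S E] unfolding V'_def by blast+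
    then show ?thesis by (auto simp: \<phi>_def \<psi>_def)
  qed
  ultimately show ?thesis by blast
qed

section \<open>The coloring maintained by the algorithm\<close>

text \<open>The presented nodes are listed in reverse order, the most recent one first.\<close>

fun virtual_coloring :: "nat \<Rightarrow> 'v list \<Rightarrow> 'v rel \<Rightarrow> 'v \<Rightarrow> nat" where
  "virtual_coloring T [] E = (\<lambda>_. 0)"
| "virtual_coloring T (v # rs) E = (SOME \<phi>. valid_state E (set (v # rs)) \<phi> \<and>
    (\<forall>u\<in>set rs. \<phi> u = virtual_coloring T rs (Restr E (near E (set rs) T)) u))"

context
  fixes E :: "'v rel" and t :: "'v \<Rightarrow> bool" and T n :: nat
  assumes sym: "sym E"
    and t: "\<And>u w. (u, w) \<in> E \<Longrightarrow> t u \<noteq> t w"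
    and T: "\<And>k. 2 ^ k \<le> n \<Longrightarrow> 3 * k + 4 \<le> T"
begin

abbreviation visible :: "'v list \<Rightarrow> 'v rel" where
  "visible rs \<equiv> Restr E (near E (set rs) T)"

text \<open>The arcs visible one step earlier can be recovered from the present ones. Hence the
  recursion of \<open>virtual_coloring\<close>, given the present arcs only, replays exactly the
  earlier choices.\<close>

lemma visible_Cons: "Restr (visible (v # rs)) (near (visible (v # rs)) (set rs) T) = visible rs"
proof -
  have "near (visible (v # rs)) (set rs) T = near E (set rs) T"
    by (rule near_restrict) auto
  moreover have "near E (set rs) T \<subseteq> near E (set (v # rs)) T"
    by (rule near_mono_rel) auto
  ultimately show ?thesis by auto
qed

text \<open>Both claims hold because \<open>SOME\<close> has a witness. The witness from
  \<open>valid_state_extend\<close> requires validity one step earlier, hence the induction.\<close>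

lemma valid_virtual_coloring:
  "length rs \<le> n \<Longrightarrow> valid_state (visible rs) (set rs) (virtual_coloring T rs (visible rs))"
  "length (v # rs) \<le> n \<Longrightarrow> u \<in> set rs \<Longrightarrow>
    virtual_coloring T (v # rs) (visible (v # rs)) u = virtual_coloring T rs (visible rs) u"
proof -
  have step: "valid_state (visible (v # rs)) (set (v # rs)) (virtual_coloring T (v # rs) (visible (v # rs))) \<and>
    (\<forall>u\<in>set rs. virtual_coloring T (v # rs) (visible (v # rs)) u = virtual_coloring T rs (visible rs) u)"
    if "length rs \<le> n" "valid_state (visible rs) (set rs) (virtual_coloring T rs (visible rs))" for v rs
  proof -
    have nr: "near (visible (v # rs)) (insert v (set rs)) T = near E (insert v (set rs)) T"
      using near_restrict[of T T "insert v (set rs)" "insert v (set rs)" E] by simp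
    have "\<exists>\<phi>. valid_state (visible (v # rs)) (insert v (set rs)) \<phi> \<and>
      (\<forall>u\<in>set rs. \<phi> u = virtual_coloring T rs (visible rs) u)"
    proof (rule valid_state_extend[where T = T and t = t])
      show "sym (visible (v # rs))" using sym by (auto simp: sym_def)
      show "visible (v # rs) \<subseteq> near (visible (v # rs)) (insert v (set rs)) T \<times>
        near (visible (v # rs)) (insert v (set rs)) T"
        unfolding nr by auto
      show "3 * k + 4 \<le> T" if "2 ^ k \<le> card (set rs)" for k
        using T[of k] that \<open>length rs \<le> n\<close> card_length[of rs] by linarith
    qed (use t that(2) visible_Cons[of v rs] in auto)
    then have "\<exists>\<phi>. valid_state (visible (v # rs)) (set (v # rs)) \<phi> \<and>
      (\<forall>u\<in>set rs. \<phi> u = virtual_coloring T rs (visible rs) u)"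
      by (simp only: list.set(2))
    then show ?thesis
      unfolding virtual_coloring.simps visible_Cons by (rule someI_ex)
  qed
  show valid: "valid_state (visible rs) (set rs) (virtual_coloring T rs (visible rs))"
    if "length rs \<le> n" for rs
    using that
  proof (induction rs)
    case Nil
    \<comment> \<open>Without presented nodes no arc is visible, and the constant bipartition
      \<open>False\<close> gives the constant color 0.\<close>
    have "near F {} k = {}" for F :: "'v rel" and k by (induction k) (auto simp: near.simps)
    then show ?case
      by (auto simp: valid_state_def intro!: exI[of _ "\<lambda>_. 0"] exI[of _ "\<lambda>_. False"])
  next
    case (Cons v rs)
    then show ?case using step[of rs v] by simp
  qed
  show "virtual_coloring T (v # rs) (visible (v # rs)) u = virtual_coloring T rs (visible rs) u"
    if "length (v # rs) \<le> n" "u \<in> set rs"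
    using step[of rs v] valid[of rs] that by simp
qed

text \<open>The color given to a node on presentation survives all later steps, so one final
  coloring describes all outputs.\<close>

lemma virtual_coloring_append:
  "length (qs @ rs) \<le> n \<Longrightarrow> u \<in> set rs \<Longrightarrow>
    virtual_coloring T (qs @ rs) (visible (qs @ rs)) u = virtual_coloring T rs (visible rs) u"
proof (induction qs)
  case (Cons q qs)
  then show ?case using valid_virtual_coloring(2)[of q "qs @ rs" u] by simp
qed simp

end

section \<open>Logarithmic locality and the theorem\<close>

definition locality :: "nat \<Rightarrow> nat" where
  "locality n = 3 * floor_log n + 4"

text \<open>Supplies the hypothesis on \<open>T\<close> above: a component of rank \<open>k\<close>
  has at least \<open>2 ^ k\<close> of the at most \<open>n\<close> presented nodes.\<close>

lemma locality_bound: "2 ^ k \<le> n \<Longrightarrow> 3 * k + 4 \<le> locality n"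
  using floor_log_mono[THEN monoD, of "2 ^ k" n] by (simp add: locality_def)

lemma locality_bigo: "(\<lambda>n. real (locality n)) \<in> O(\<lambda>n. ln (real n))"
proof (rule bigoI)
  \<comment> \<open>The constant is \<open>3 + 4\<close>, since \<open>1 \<le> log 2 n\<close> for
    \<open>n \<ge> 2\<close>; at \<open>n = 1\<close> the logarithm vanishes.\<close>
  show "\<forall>\<^sub>F n in at_top. norm (real (locality n)) \<le> (7 / ln 2) * norm (ln (real n))"
    using eventually_ge_at_top[of 2]
  proof eventually_elim
    case (elim n)
    have "real (2 ^ floor_log n) \<le> real n"
      using floor_log_exp2_le[of n] elim by (intro of_nat_mono) simp
    then have "ln (2 ^ floor_log n) \<le> ln (real n)"
      using elim by (subst ln_le_cancel_iff) auto
    then have "real (floor_log n) * ln 2 \<le> ln (real n)" by (simp add: ln_realpow)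
    moreover have "ln 2 \<le> ln (real n)" using elim by simp
    ultimately have "real (locality n) * ln 2 \<le> 7 * ln (real n)"
      by (simp add: locality_def algebra_simps)
    moreover have "0 < ln (real n)" using elim by simp
    ultimately show ?case by (simp add: field_simps)
  qed
qed

theorem theorem1p1:
  shows "\<exists>(T :: nat \<Rightarrow> nat) (A :: ('v, nat) online_algorithm).
    (\<lambda>n. real (T n)) \<in> O(\<lambda>n. ln (real n)) \<and>
    solves_online_LOCAL A T bipartite (proper_coloring 3)"
proof -
  define A :: "('v, nat) online_algorithm" where
    "A n ws H = virtual_coloring (locality n) (rev ws) (parcs H) (last ws)" for n ws H
  have "proper_coloring 3 G (online_labeling A locality G vs)"
    if G: "pair_graph G" and bip: "bipartite G" and ord: "is_ordering G vs"
    for G :: "'v pair_pre_digraph" and vs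
  proof -
    interpret pair_graph G by fact
    define n where "n = card (pverts G)"
    \<comment> \<open>The coloring after the last step, on the whole graph. Each label turns out to
      be its value, so properness is checked only once.\<close>
    define \<phi> where "\<phi> = virtual_coloring (locality n) (rev vs) (parcs G)"
    have vs: "distinct vs" "set vs = pverts G" "length vs = n"
      using ord by (auto simp: is_ordering_def n_def simp flip: distinct_card)
    obtain X Y where XY: "X \<inter> Y = {}" "parcs G \<subseteq> X \<times> Y \<union> Y \<times> X"
      using bip by (auto simp: bipartite_def)
    have sym: "sym (parcs G)" using sym_arcs by (simp add: symmetric_def arcs_ends_def arc_to_ends_def)
    have t: "(u \<in> X) \<noteq> (w \<in> X)" if "(u, w) \<in> parcs G" for u w
      using that XY by blast
    note ctx = sym t locality_bound
    have all: "Restr (parcs G) (near (parcs G) (set (rev vs)) k) = parcs G" for k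
      using near_increasing[of "set vs" "parcs G" k] vs(2) in_arcsD1 in_arcsD2 by (auto simp: subset_iff)
    have label: "online_labeling A locality G vs v = \<phi> v" if v: "v \<in> pverts G" for v
    proof -
      obtain i where i: "i < length vs" "v = vs ! i" using v vs(2) by (metis in_set_conv_nth)
      let ?ws = "take (Suc i) vs"
      have split: "rev vs = rev (drop (Suc i) vs) @ rev ?ws"
        by (metis append_take_drop_id rev_append)
      have last: "last ?ws = v" using i by (simp add: take_Suc_conv_app_nth)
      have mem: "v \<in> set (rev ?ws)" using i by (simp add: take_Suc_conv_app_nth)
      have "online_labeling A locality G vs v = A n ?ws (revealed G (locality n) ?ws)"
        using online_labeling_nth[OF vs(1) i(1), of A locality G] i(2) by (simp add: n_def)
      also have "\<dots> = virtual_coloring (locality n) (rev ?ws)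
          (Restr (parcs G) (near (parcs G) (set (rev ?ws)) (locality n))) v"
        using parcs_revealed[OF G, of ?ws "locality n"] set_take_subset[of "Suc i" vs] vs(2) last
        by (simp add: A_def)
      also have "\<dots> = virtual_coloring (locality n) (rev vs)
          (Restr (parcs G) (near (parcs G) (set (rev vs)) (locality n))) v"
        unfolding split using virtual_coloring_append[OF ctx, where n = n and qs = "rev (drop (Suc i) vs)" and rs = "rev ?ws" and u = v]
          mem vs(3) by simp
      also have "\<dots> = \<phi> v" unfolding \<phi>_def all ..
      finally show ?thesis .
    qed
    have "valid_state (parcs G) (pverts G) \<phi>"
      using valid_virtual_coloring(1)[OF ctx, where n = n and rs = "rev vs"] vs unfolding all \<phi>_def by simp
    then have "\<phi> u < 3" "(u, w) \<in> parcs G \<Longrightarrow> \<phi> u \<noteq> \<phi> w" for u w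
      by (auto simp: valid_state_def)
    then show ?thesis
      using label in_arcsD1 in_arcsD2 by (auto simp: proper_coloring_def)
  qed
  then have "solves_online_LOCAL A locality bipartite (proper_coloring 3)"
    by (simp add: solves_online_LOCAL_def)
  then show ?thesis using locality_bigo by blast
qed

end
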